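(* Consider an $M$-dimensional quantum system with $n$ measurements and outcome variables $Y_1,\dots,Y_n$ with joint probability mass function $p(y_1,\dots,y_n)$, and let $\rho_k$ and $\tilde\rho_k$ be the (normalized) pre- and post-measurement density matrices, all as defined in the context. Let $1\le k\le n$ and suppose that the $k$-th measurement is of the basic projection type with unitary matrix $B_k$; let $B_k(y)$ denote the $y$-th column of $B_k$. Let $y_1,\dots,y_{k-1}$ be outcomes with $P(Y_1=y_1,\dots,Y_{k-1}=y_{k-1})>0$. Then for every $y\in\{1,\dots,M\}$, $$P(Y_k=y\mid Y_{k-1}=y_{k-1},\dots,Y_1=y_1)=B_k(y)^{\mathsf H}\rho_kB_k(y)=\operatorname{tr}\!\left(B_k(y)B_k(y)^{\mathsf H}\rho_k\right).$$ Moreover, after observing $Y_k=y$ (where this conditional probability is positive), the density matrix is $$\tilde\rho_k=B_k(y)B_k(y)^{\mathsf H}.$$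
   Context: A matrix $A\in\mathbb{C}^{M\times M}$ is viewed as a function $(x,y)\mapsto A(x,y)$, with row index $x$ and column index $y$. $A^{\mathsf H}$ is the Hermitian transpose, $\overline{\,\cdot\,}$ is complex conjugation, and $I$ is the identity matrix. The equality constraint function is $f_=(x,x')=1$ if $x=x'$ and $0$ otherwise. System. Let $M,n\ge1$ be integers, $p(x_0)$ a probability mass function on $\{1,\dots,M\}$, $U_0,\dots,U_{n-1}\in\mathbb{C}^{M\times M}$ unitary matrices, and for $k=1,\dots,n$ let $f_k(x_k,x_k',\tilde x_k,\tilde x_k',y_k)$ be a measurement factor with $x_k,x_k',\tilde x_k,\tilde x_k'\in\{1,\dots,M\}$ and $y_k$ in a finite set $\mathcal{Y}_k$, of one of two types. (i) Basic projection type: $\mathcal{Y}_k=\{1,\dots,M\}$, and for some unitary $B_k\in\mathbb{C}^{M\times M}$, $$f_k(x_k,x_k',\tilde x_k,\tilde x_k',y)=B_k(\tilde x_k,y)\,\overline{B_k(x_k,y)}\;B_k(x_k',y)\,\overline{B_k(\tilde x_k',y)}.$$ (ii) General type: there are matrices $A_k(y)\in\mathbb{C}^{M\times M}$, $y\in\mathcal{Y}_k$, with $\sum_{y\in\mathcal{Y}_k}A_k(y)^{\mathsf H}A_k(y)=I$, such that $$f_k(x_k,x_k',\tilde x_k,\tilde x_k',y)=A_k(y)(\tilde x_k,x_k)\;\overline{A_k(y)(\tilde x_k',x_k')}.$$ Joint distribution. The joint probability mass function of $Y_1,\dots,Y_n$ is $$p(y_1,\dots,y_n)=\sum p(x_0)\,U_0(x_1,x_0)\overline{U_0(x_1',x_0)}\prod_{j=1}^{n}f_j(x_j,x_j',\tilde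 x_j,\tilde x_j',y_j)\prod_{j=1}^{n-1}U_j(x_{j+1},\tilde x_j)\,\overline{U_j(x_{j+1}',\tilde x_j')}\;f_=(\tilde x_n,\tilde x_n'),$$ where the sum is over $x_0$ and all $x_j,x_j',\tilde x_j,\tilde x_j'$, $1\le j\le n$, each in $\{1,\dots,M\}$ (this function is a probability mass function on $\mathcal{Y}_1\times\cdots\times\mathcal{Y}_n$). $P$ denotes probability with respect to it. Density matrices. For fixed outcomes $y_1,y_2,\dots$, define the $M\times M$ matrices $$C_k(x_k,x_k')=\sum p(x_0)\,U_0(x_1,x_0)\overline{U_0(x_1',x_0)}\prod_{j=1}^{k-1}\Big[f_j(x_j,x_j',\tilde x_j,\tilde x_j',y_j)\,U_j(x_{j+1},\tilde x_j)\,\overline{U_j(x_{j+1}',\tilde x_j')}\Big],$$ where the sum is over $x_0$ and all $x_j,x_j',\tilde x_j,\tilde x_j'$ with $1\le j\le k-1$, and $$D_k(\tilde x_k,\tilde x_k')=\sum p(x_0)\,U_0(x_1,x_0)\overline{U_0(x_1',x_0)}\prod_{j=1}^{k-1}\Big[f_j(x_j,x_j',\tilde x_j,\tilde x_j',y_j)\,U_j(x_{j+1},\tilde x_j)\,\overline{U_j(x_{j+1}',\tilde x_j')}\Big]f_k(x_k,x_k',\tilde x_k,\tilde x_k',y_k),$$ where the sum is over $x_0$, all $x_j,x_j',\tilde x_j,\tilde x_j'$ with $1\le j\le k-1$, and $x_k,x_k'$. The density matrix before the $k$-th measurement (given $y_1,\dots,y_{k-1}$) is $\rho_k=C_k/\operatorname{tr}(C_k)$,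 and the density matrix after observing $Y_k=y_k$ (given $y_1,\dots,y_k$) is $\tilde\rho_k=D_k/\operatorname{tr}(D_k)$; these are defined when the respective trace is nonzero, which is the case when the respective outcomes have positive probability. *)

theory Defs
  imports "HOL-Probability.Probability"
begin

text \<open>
  The index set \<open>{1, \<dots>, M}\<close> is a finite type \<open>'m\<close>, so that \<open>M = CARD('m) \<ge> 1\<close>.
  Entry \<open>A(x, y)\<close> of a matrix is \<open>A $ x $ y\<close>.

  The alphabets \<open>\<Y>\<^sub>k\<close> may differ from measurement to measurement, and the alphabet of a basic
  projection is the index set itself.  All of them are therefore subsets of one type
  \<open>'m + 'y\<close>, where \<open>Inl\<close> embeds the index set and \<open>'y\<close> is an arbitrary type of further outcomes.
\<close>

definition hermitian_transpose :: "complex^'n^'m \<Rightarrow> complex^'m^'n" where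
  "hermitian_transpose A = map_matrix cnj (transpose A)"

definition unitary :: "complex^'m^'m \<Rightarrow> bool" where
  "unitary A \<longleftrightarrow> hermitian_transpose A ** A = mat 1 \<and> A ** hermitian_transpose A = mat 1"

text \<open>The column \<open>B(y)\<close>, as a matrix with a single column.\<close>

definition col :: "complex^'m^'m \<Rightarrow> 'm \<Rightarrow> complex^1^'m" where
  "col B y = columnvector (column y B)"

definition equality_constraint :: "'m \<Rightarrow> 'm \<Rightarrow> complex" where
  "equality_constraint a a' = (if a = a' then 1 else 0)"


text \<open>
  A measurement factor takes its arguments in the order
  \<open>x\<^sub>k, x\<^sub>k', \<tilde>x\<^sub>k, \<tilde>x\<^sub>k', y\<^sub>k\<close>; in variable names, \<open>xt\<close> stands for \<open>\<tilde>x\<close>.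
  Only its values for outcomes in the alphabet are constrained.
\<close>

type_synonym ('m, 'y) factor = "'m \<Rightarrow> 'm \<Rightarrow> 'm \<Rightarrow> 'm \<Rightarrow> 'm + 'y \<Rightarrow> complex"

definition basic_projection ::
    "complex^'m^'m \<Rightarrow> ('m + 'y) set \<Rightarrow> ('m::finite, 'y) factor \<Rightarrow> bool" where
  "basic_projection B Y f \<longleftrightarrow>
     Y = range Inl \<and> unitary B \<and>
     (\<forall>x x' xt xt' y. f x x' xt xt' (Inl y) =
        B $ xt $ y * cnj (B $ x $ y) * (B $ x' $ y * cnj (B $ xt' $ y)))"

definition general_measurement :: "('m + 'y) set \<Rightarrow> ('m::finite, 'y) factor \<Rightarrow> bool" where
  "general_measurement Y f \<longleftrightarrow>
     finite Y \<and>
     (\<exists>A :: 'm + 'y \<Rightarrow> complex^'m^'m.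
        (\<Sum>y\<in>Y. hermitian_transpose (A y) ** A y) = mat 1 \<and>
        (\<forall>x x' xt xt'. \<forall>y\<in>Y. f x x' xt xt' y = A y $ xt $ x * cnj (A y $ xt' $ x')))"

definition measurement_factor :: "('m + 'y) set \<Rightarrow> ('m::finite, 'y) factor \<Rightarrow> bool" where
  "measurement_factor Y f \<longleftrightarrow> (\<exists>B. basic_projection B Y f) \<or> general_measurement Y f"


text \<open>Assignments of values to variables with indices \<open>1, \<dots>, k\<close>.\<close>

abbreviation paths :: "nat \<Rightarrow> (nat \<Rightarrow> 'm) set" where
  "paths k \<equiv> {1..k} \<rightarrow>\<^sub>E UNIV"

definition joint_mass ::
    "nat \<Rightarrow> 'm pmf \<Rightarrow> (nat \<Rightarrow> complex^'m^'m) \<Rightarrow> (nat \<Rightarrow> ('m::finite, 'y) factor) \<Rightarrow>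
     (nat \<Rightarrow> 'm + 'y) \<Rightarrow> complex" where
  "joint_mass n p U f y =
     (\<Sum>x0\<in>UNIV. \<Sum>x\<in>paths n. \<Sum>x'\<in>paths n. \<Sum>xt\<in>paths n. \<Sum>xt'\<in>paths n.
        complex_of_real (pmf p x0) * U 0 $ x 1 $ x0 * cnj (U 0 $ x' 1 $ x0) *
        (\<Prod>j=1..n. f j (x j) (x' j) (xt j) (xt' j) (y j)) *
        (\<Prod>j=1..n-1. U j $ x (j+1) $ xt j * cnj (U j $ x' (j+1) $ xt' j)) *
        equality_constraint (xt n) (xt' n))"

text \<open>
  The probability space of \<open>(Y\<^sub>1, \<dots>, Y\<^sub>n)\<close>, in which \<open>Y\<^sub>k\<close> is the coordinate map \<open>\<lambda>\<omega>. \<omega> k\<close>.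
  For unitary \<open>U j\<close> and measurement factors \<open>f j\<close>, the values of \<open>joint_mass\<close> on this space are
  nonnegative reals, so that \<open>Re\<close> and \<open>ennreal\<close> only change their type.
\<close>

definition outcome_measure ::
    "nat \<Rightarrow> 'm pmf \<Rightarrow> (nat \<Rightarrow> complex^'m^'m) \<Rightarrow> (nat \<Rightarrow> ('m + 'y) set) \<Rightarrow>
     (nat \<Rightarrow> ('m::finite, 'y) factor) \<Rightarrow> (nat \<Rightarrow> 'm + 'y) measure" where
  "outcome_measure n p U Y f =
     point_measure (PiE {1..n} Y) (\<lambda>y. ennreal (Re (joint_mass n p U f y)))"


definition prefix_weight ::
    "'m pmf \<Rightarrow> (nat \<Rightarrow> complex^'m^'m) \<Rightarrow> (nat \<Rightarrow> ('m::finite, 'y) factor) \<Rightarrow> (nat \<Rightarrow> 'm + 'y) \<Rightarrow>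
     nat \<Rightarrow> 'm \<Rightarrow> (nat \<Rightarrow> 'm) \<Rightarrow> (nat \<Rightarrow> 'm) \<Rightarrow> (nat \<Rightarrow> 'm) \<Rightarrow> (nat \<Rightarrow> 'm) \<Rightarrow> complex" where
  "prefix_weight p U f y k x0 x x' xt xt' =
     complex_of_real (pmf p x0) * U 0 $ x 1 $ x0 * cnj (U 0 $ x' 1 $ x0) *
     (\<Prod>j=1..k-1. f j (x j) (x' j) (xt j) (xt' j) (y j) *
        U j $ x (j+1) $ xt j * cnj (U j $ x' (j+1) $ xt' j))"

text \<open>
  The matrices \<open>C\<^sub>k\<close> and \<open>D\<^sub>k\<close>, for \<open>k \<ge> 1\<close>.  A variable that is an argument of the matrix rather
  than summed over has its value fixed by a constraint on the assignments.
\<close>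

definition pre_matrix ::
    "'m pmf \<Rightarrow> (nat \<Rightarrow> complex^'m^'m) \<Rightarrow> (nat \<Rightarrow> ('m::finite, 'y) factor) \<Rightarrow> (nat \<Rightarrow> 'm + 'y) \<Rightarrow>
     nat \<Rightarrow> complex^'m^'m" where
  "pre_matrix p U f y k =
     (\<chi> a a'. \<Sum>x0\<in>UNIV.
        \<Sum>x\<in>{x \<in> paths k. x k = a}. \<Sum>x'\<in>{x' \<in> paths k. x' k = a'}.
        \<Sum>xt\<in>paths (k-1). \<Sum>xt'\<in>paths (k-1).
          prefix_weight p U f y k x0 x x' xt xt')"

definition post_matrix ::
    "'m pmf \<Rightarrow> (nat \<Rightarrow> complex^'m^'m) \<Rightarrow> (nat \<Rightarrow> ('m::finite, 'y) factor) \<Rightarrow> (nat \<Rightarrow> 'm + 'y) \<Rightarrow>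
     nat \<Rightarrow> complex^'m^'m" where
  "post_matrix p U f y k =
     (\<chi> a a'. \<Sum>x0\<in>UNIV.
        \<Sum>x\<in>paths k. \<Sum>x'\<in>paths k.
        \<Sum>xt\<in>{xt \<in> paths k. xt k = a}. \<Sum>xt'\<in>{xt' \<in> paths k. xt' k = a'}.
          prefix_weight p U f y k x0 x x' xt xt' * f k (x k) (x' k) (xt k) (xt' k) (y k))"

definition trace_normalize :: "complex^'m^'m \<Rightarrow> complex^'m^'m" where
  "trace_normalize A = map_matrix (\<lambda>z. z / trace A) A"

definition pre_density ::
    "'m pmf \<Rightarrow> (nat \<Rightarrow> complex^'m^'m) \<Rightarrow> (nat \<Rightarrow> ('m::finite, 'y) factor) \<Rightarrow> (nat \<Rightarrow> 'm + 'y) \<Rightarrow>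
     nat \<Rightarrow> complex^'m^'m" where
  "pre_density p U f y k = trace_normalize (pre_matrix p U f y k)"

definition post_density ::
    "'m pmf \<Rightarrow> (nat \<Rightarrow> complex^'m^'m) \<Rightarrow> (nat \<Rightarrow> ('m::finite, 'y) factor) \<Rightarrow> (nat \<Rightarrow> 'm + 'y) \<Rightarrow>
     nat \<Rightarrow> complex^'m^'m" where
  "post_density p U f y k = trace_normalize (post_matrix p U f y k)"

end

theory Submission
  imports Defs
begin

text \<open>
  Summing over the last variables of the paths gives the recursion
  \<open>D\<^sub>k = A\<^sub>k(y\<^sub>k) C\<^sub>k A\<^sub>k(y\<^sub>k)\<^sup>H\<close>, \<open>C\<^sub>k\<^sub>+\<^sub>1 = U\<^sub>k D\<^sub>k U\<^sub>k\<^sup>H\<close>, where a basic projection has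
  \<open>A\<^sub>k(y) = B\<^sub>k(y) B\<^sub>k(y)\<^sup>H\<close>.  Hence \<open>D\<^sub>k = K diag(p) K\<^sup>H\<close> with
  \<open>K = A\<^sub>k(y\<^sub>k) U\<^sub>k\<^sub>-\<^sub>1 \<dots> A\<^sub>1(y\<^sub>1) U\<^sub>0\<close>, whose trace is real and nonnegative.  Unitarity and
  completeness make the sum of \<open>tr D\<^sub>k\<close> over \<open>y\<^sub>k\<close> equal to \<open>tr D\<^sub>k\<^sub>-\<^sub>1\<close>, so \<open>tr D\<^sub>k = P(Y\<^sub>1 = y\<^sub>1, \<dots>, Y\<^sub>k = y\<^sub>k)\<close>
  and \<open>tr C\<^sub>k = P(Y\<^sub>1 = y\<^sub>1, \<dots>, Y\<^sub>k\<^sub>-\<^sub>1 = y\<^sub>k\<^sub>-\<^sub>1)\<close>.  For a basic projection \<open>D\<^sub>k\<close> is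
  \<open>B\<^sub>k(y)\<^sup>H C\<^sub>k B\<^sub>k(y)\<close> times the matrix \<open>B\<^sub>k(y) B\<^sub>k(y)\<^sup>H\<close> of trace \<open>1\<close>.
\<close>

section \<open>Sums over finite assignments: splitting off the last variable and grouping by its
  value\<close>

lemma PiE_fun_upd_Suc:
  "x \<in> PiE {1..k} S \<Longrightarrow> a \<in> S (Suc k) \<Longrightarrow> x(Suc k := a) \<in> PiE {1..Suc k} S"
  by (simp add: atLeastAtMostSuc_conv PiE_fun_upd)

lemma PiE_restrict_Suc:
  assumes "x \<in> PiE {1..Suc k} S"
  shows "restrict x {1..k} \<in> PiE {1..k} S" "(restrict x {1..k})(Suc k := x (Suc k)) = x"
  using assms by (auto simp: PiE_iff extensional_def fun_eq_iff le_Suc_eq)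

lemma restrict_fun_upd_Suc:
  "x \<in> PiE {1..k} S \<Longrightarrow> restrict (x(Suc k := a)) {1..k} = x"
  by (auto simp: PiE_iff extensional_def fun_eq_iff)

text \<open>Restriction and update at \<open>Suc k\<close> are inverse bijections once the last
  value is prescribed. This removes the constraints by which \<open>pre_matrix\<close> and
  \<open>post_matrix\<close> encode their matrix indices.\<close>

lemma sum_PiE_Suc_fixed:
  assumes "a \<in> S (Suc k)"
  shows "(\<Sum>x\<in>{x \<in> PiE {1..Suc k} S. x (Suc k) = a}. g x) = (\<Sum>x\<in>PiE {1..k} S. g (x(Suc k := a)))"
proof (rule sum.reindex_bij_witness[where i = "\<lambda>x. x(Suc k := a)" and j = "\<lambda>x. restrict x {1..k}"])
  fix x assume "x \<in> {x \<in> PiE {1..Suc k} S. x (Suc k) = a}"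
  then have x: "x \<in> PiE {1..Suc k} S" and a: "a = x (Suc k)"
    by auto
  show "(restrict x {1..k})(Suc k := a) = x" "restrict x {1..k} \<in> PiE {1..k} S"
      "g ((restrict x {1..k})(Suc k := a)) = g x"
    using PiE_restrict_Suc[OF x] unfolding a by simp_all
next
  fix x assume x: "x \<in> PiE {1..k} S"
  show "restrict (x(Suc k := a)) {1..k} = x"
    by (rule restrict_fun_upd_Suc[OF x])
  show "x(Suc k := a) \<in> {x \<in> PiE {1..Suc k} S. x (Suc k) = a}"
    using PiE_fun_upd_Suc[where S = S, OF x assms] by simp
qed

text \<open>Read from right to left, this introduces a matrix index \<open>b\<close> for the value
  \<open>h x\<close> of a path variable. The separate argument \<open>b\<close> of \<open>g\<close>
  lets factors that depend on \<open>h x\<close> become constants on each fiber.\<close>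

lemma sum_fibers:
  fixes g :: "'a \<Rightarrow> 'b::finite \<Rightarrow> 'c::comm_monoid_add"
  assumes "finite S"
  shows "(\<Sum>b\<in>UNIV. \<Sum>x\<in>{x \<in> S. h x = b}. g x b) = (\<Sum>x\<in>S. g x (h x))"
proof -
  have "(\<Sum>b\<in>UNIV. \<Sum>x\<in>{x \<in> S. h x = b}. g x b) = (\<Sum>b\<in>UNIV. \<Sum>x\<in>{x \<in> S. h x = b}. g x (h x))"
    by (intro sum.cong) auto
  also have "\<dots> = (\<Sum>x\<in>S. g x (h x))"
    using assms by (intro sum.group) auto
  finally show ?thesis .
qed

lemma sum_fibers2:
  fixes g :: "'a \<Rightarrow> 'a' \<Rightarrow> 'b::finite \<Rightarrow> 'd::finite \<Rightarrow> 'c::comm_monoid_add"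
  assumes "finite S" "finite T"
  shows "(\<Sum>b\<in>UNIV. \<Sum>b'\<in>UNIV. \<Sum>x\<in>{x \<in> S. h x = b}. \<Sum>x'\<in>{x' \<in> T. h' x' = b'}. g x x' b b')
    = (\<Sum>x\<in>S. \<Sum>x'\<in>T. g x x' (h x) (h' x'))"
proof -
  have "(\<Sum>b\<in>UNIV. \<Sum>b'\<in>UNIV. \<Sum>x\<in>{x \<in> S. h x = b}. \<Sum>x'\<in>{x' \<in> T. h' x' = b'}. g x x' b b')
     = (\<Sum>b\<in>UNIV. \<Sum>x\<in>{x \<in> S. h x = b}. \<Sum>b'\<in>UNIV. \<Sum>x'\<in>{x' \<in> T. h' x' = b'}. g x x' b b')"
    by (intro sum.cong sum.swap refl)
  also have "\<dots> = (\<Sum>x\<in>S. \<Sum>b'\<in>UNIV. \<Sum>x'\<in>{x' \<in> T. h' x' = b'}. g x x' (h x) b')"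
    by (rule sum_fibers[OF assms(1)])
  also have "\<dots> = (\<Sum>x\<in>S. \<Sum>x'\<in>T. g x x' (h x) (h' x'))"
    by (intro sum.cong sum_fibers[OF assms(2)] refl)
  finally show ?thesis .
qed

lemma sum_pull2:
  "(\<Sum>b\<in>S. \<Sum>b'\<in>T. \<Sum>z\<in>Z. g b b' z) = (\<Sum>z\<in>Z. \<Sum>b\<in>S. \<Sum>b'\<in>T. g b b' z)"
proof -
  have "(\<Sum>b\<in>S. \<Sum>b'\<in>T. \<Sum>z\<in>Z. g b b' z) = (\<Sum>b\<in>S. \<Sum>z\<in>Z. \<Sum>b'\<in>T. g b b' z)"
    by (intro sum.cong sum.swap refl)
  also have "\<dots> = (\<Sum>z\<in>Z. \<Sum>b\<in>S. \<Sum>b'\<in>T. g b b' z)"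
    by (rule sum.swap)
  finally show ?thesis .
qed

text \<open>Used to bring two matrix-index sums outside the sums over \<open>x0\<close>,
  \<open>x\<close> and \<open>x'\<close>.\<close>

lemma sum_pull2_nested:
  "(\<Sum>b\<in>S. \<Sum>b'\<in>T. \<Sum>x\<in>X. \<Sum>y\<in>Y. \<Sum>z\<in>Z. g b b' x y z)
    = (\<Sum>x\<in>X. \<Sum>y\<in>Y. \<Sum>z\<in>Z. \<Sum>b\<in>S. \<Sum>b'\<in>T. g b b' x y z)"
proof -
  have "(\<Sum>b\<in>S. \<Sum>b'\<in>T. \<Sum>x\<in>X. \<Sum>y\<in>Y. \<Sum>z\<in>Z. g b b' x y z)
      = (\<Sum>x\<in>X. \<Sum>b\<in>S. \<Sum>b'\<in>T. \<Sum>y\<in>Y. \<Sum>z\<in>Z. g b b' x y z)"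
    by (rule sum_pull2)
  also have "\<dots> = (\<Sum>x\<in>X. \<Sum>y\<in>Y. \<Sum>b\<in>S. \<Sum>b'\<in>T. \<Sum>z\<in>Z. g b b' x y z)"
    by (intro sum.cong refl sum_pull2)
  also have "\<dots> = (\<Sum>x\<in>X. \<Sum>y\<in>Y. \<Sum>z\<in>Z. \<Sum>b\<in>S. \<Sum>b'\<in>T. g b b' x y z)"
    by (intro sum.cong refl sum_pull2)
  finally show ?thesis .
qed

lemma finite_paths [simp]: "finite (paths k :: (nat \<Rightarrow> 'm::finite) set)"
  by (intro finite_PiE) auto

section \<open>Conjugation of matrices, its trace, and completeness of a measurement\<close>

lemma hermitian_transpose_mult:
  "hermitian_transpose (A ** B) = hermitian_transpose B ** hermitian_transpose A"
  by (simp add: hermitian_transpose_def map_matrix_def transpose_def matrix_matrix_mult_def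
      vec_eq_iff mult.commute)

lemma conjugation_nth:
  "(A ** X ** hermitian_transpose A) $ a $ a'
    = (\<Sum>b\<in>UNIV. \<Sum>b'\<in>UNIV. X $ b $ b' * (A $ a $ b * cnj (A $ a' $ b')))"
  unfolding matrix_matrix_mult_def hermitian_transpose_def map_matrix_def transpose_def
  by (simp add: sum_distrib_right) (subst sum.swap, simp add: algebra_simps)

lemma trace_conjugation:
  "trace (A ** X ** hermitian_transpose A) = trace (hermitian_transpose A ** A ** X)"
  by (metis trace_mul_sym matrix_mul_assoc)

text \<open>Cyclicity brings \<open>hermitian_transpose (A y)\<close> and \<open>A y\<close>
  together; linearity of the trace then lets the completeness relation act. A measurement thus
  preserves the trace once its outcomes are summed.\<close>

lemma sum_trace_conjugation:
  assumes "(\<Sum>y\<in>Y. hermitian_transpose (A y) ** A y) = mat 1"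
  shows "(\<Sum>y\<in>Y. trace (A y ** X ** hermitian_transpose (A y))) = trace X"
proof -
  have "(\<Sum>y\<in>Y. trace (A y ** X ** hermitian_transpose (A y)))
      = (\<Sum>y\<in>Y. trace (hermitian_transpose (A y) ** A y ** X))"
    by (simp add: trace_conjugation)
  also have "\<dots> = trace ((\<Sum>y\<in>Y. hermitian_transpose (A y) ** A y) ** X)"
    unfolding trace_def matrix_matrix_mult_def[of _ X]
    by (simp add: sum_distrib_right) (rule sum_pull2[symmetric])
  finally show ?thesis
    by (simp add: assms)
qed

text \<open>Column \<open>y\<close> of \<open>B\<close> has norm 1 (\<open>cols\<close>), so its
  outer product with itself is Hermitian and idempotent. Hence the sum of the
  \<open>hermitian_transpose (A y) ** A y\<close> is the sum of the projections, which is the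
  identity because the rows of \<open>B\<close> are orthonormal (\<open>rows\<close>).\<close>

lemma basic_projection_general:
  fixes B :: "complex^'m^'m" and f :: "('m::finite, 'y) factor"
  assumes "basic_projection B Y f"
  shows "general_measurement Y f"
proof -
  have Y: "Y = range Inl" and U: "unitary B"
    and f: "\<And>x x' xt xt' y. f x x' xt xt' (Inl y) =
        B $ xt $ y * cnj (B $ x $ y) * (B $ x' $ y * cnj (B $ xt' $ y))"
    using assms by (auto simp: basic_projection_def)
  \<comment> \<open>Outcomes \<open>Inr y\<close> lie outside the alphabet \<open>range Inl\<close>;
    0 is a default value there.\<close>
  define A :: "'m + 'y \<Rightarrow> complex^'m^'m"
    where "A = (\<lambda>y. case y of Inl y \<Rightarrow> (\<chi> a b. B $ a $ y * cnj (B $ b $ y)) | Inr y \<Rightarrow> 0)"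
  have cols: "(\<Sum>c\<in>UNIV. cnj (B $ c $ y) * B $ c $ y) = 1" for y
    using U by (auto simp: unitary_def vec_eq_iff matrix_matrix_mult_def hermitian_transpose_def
        map_matrix_def transpose_def mat_def)
  have rows: "(\<Sum>y\<in>UNIV. B $ a $ y * cnj (B $ b $ y)) = (if a = b then 1 else 0)" for a b
    using U by (auto simp: unitary_def vec_eq_iff matrix_matrix_mult_def hermitian_transpose_def
        map_matrix_def transpose_def mat_def)
  have "(hermitian_transpose (A (Inl y)) ** A (Inl y)) $ a $ b = B $ a $ y * cnj (B $ b $ y)" for y a b
  proof -
    have "(hermitian_transpose (A (Inl y)) ** A (Inl y)) $ a $ b
       = (\<Sum>c\<in>UNIV. cnj (B $ c $ y) * B $ c $ y) * (B $ a $ y * cnj (B $ b $ y))"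
      unfolding sum_distrib_right
      by (simp add: A_def matrix_matrix_mult_def hermitian_transpose_def map_matrix_def
          transpose_def algebra_simps)
    then show ?thesis by (simp add: cols)
  qed
  then have "(\<Sum>y\<in>Y. hermitian_transpose (A y) ** A y) = mat 1"
    unfolding Y vec_eq_iff by (simp add: sum.reindex rows mat_def)
  then show ?thesis
    unfolding general_measurement_def Y
    by (intro conjI exI[of _ A]) (auto simp: A_def f)
qed

section \<open>The recursion between the matrices before and after each measurement\<close>

text \<open>The ranges differ because the product stops at \<open>k-1\<close> while its unitary
  factors read \<open>x (j+1)\<close> and \<open>x' (j+1)\<close>, hence positions up to
  \<open>k\<close>.\<close>

lemma prefix_weight_cong:
  assumes "1 \<le> k" "\<And>j. j \<in> {1..k} \<Longrightarrow> x j = z j" "\<And>j. j \<in> {1..k} \<Longrightarrow> x' j = z' j"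
    "\<And>j. j \<in> {1..<k} \<Longrightarrow> xt j = zt j" "\<And>j. j \<in> {1..<k} \<Longrightarrow> xt' j = zt' j"
    "\<And>j. j \<in> {1..<k} \<Longrightarrow> y j = w j"
  shows "prefix_weight p U f y k x0 x x' xt xt' = prefix_weight p U f w k x0 z z' zt zt'"
proof -
  have "(\<Prod>j=1..k-1. f j (x j) (x' j) (xt j) (xt' j) (y j) *
        U j $ x (j+1) $ xt j * cnj (U j $ x' (j+1) $ xt' j))
     = (\<Prod>j=1..k-1. f j (z j) (z' j) (zt j) (zt' j) (w j) *
        U j $ z (j+1) $ zt j * cnj (U j $ z' (j+1) $ zt' j))"
  proof (intro prod.cong refl)
    fix j assume "j \<in> {1..k-1}"
    then have "j \<in> {1..k}" "j + 1 \<in> {1..k}" "j \<in> {1..<k}"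
      by auto
    then show "f j (x j) (x' j) (xt j) (xt' j) (y j) * U j $ x (j+1) $ xt j * cnj (U j $ x' (j+1) $ xt' j)
       = f j (z j) (z' j) (zt j) (zt' j) (w j) * U j $ z (j+1) $ zt j * cnj (U j $ z' (j+1) $ zt' j)"
      by (simp only: assms)
  qed
  moreover have "x 1 = z 1" "x' 1 = z' 1"
    using assms(1) by (auto intro!: assms(2,3))
  ultimately show ?thesis
    by (simp add: prefix_weight_def)
qed

lemma pre_matrix_cong:
  assumes "1 \<le> k" "\<And>j. j \<in> {1..<k} \<Longrightarrow> y j = w j"
  shows "pre_matrix p U f y k = pre_matrix p U f w k"
  unfolding pre_matrix_def by (intro arg_cong[where f = vec_lambda] ext sum.cong refl prefix_weight_cong assms)

lemma prefix_weight_Suc: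
  assumes "1 \<le> k"
  shows "prefix_weight p U f y (Suc k) x0 x x' xt xt' =
     prefix_weight p U f y k x0 x x' xt xt' * f k (x k) (x' k) (xt k) (xt' k) (y k) *
     (U k $ x (Suc k) $ xt k * cnj (U k $ x' (Suc k) $ xt' k))"
proof -
  have "{1..Suc k - 1} = insert k {1..k-1}"
    using assms by auto
  then show ?thesis
    using assms by (simp add: prefix_weight_def algebra_simps)
qed

lemma pre_matrix_1:
  "pre_matrix p U f y (Suc 0) $ a $ a'
    = (\<Sum>x0\<in>UNIV. complex_of_real (pmf p x0) * U 0 $ a $ x0 * cnj (U 0 $ a' $ x0))"
proof -
  \<comment> \<open>Fixing the only coordinate leaves a single extensional path.\<close>
  have *: "{x \<in> {Suc 0} \<rightarrow>\<^sub>E UNIV. x (Suc 0) = a} = {(\<lambda>_. undefined)(Suc 0 := a)}" for a :: 'a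
    by (auto simp: PiE_iff extensional_def fun_eq_iff)
  show ?thesis
    unfolding pre_matrix_def by (simp add: * prefix_weight_def)
qed

lemma post_matrix_nth:
  assumes "1 \<le> k"
  shows "post_matrix p U f y k $ a $ a'
    = (\<Sum>b\<in>UNIV. \<Sum>b'\<in>UNIV. pre_matrix p U f y k $ b $ b' * f k b b' a a' (y k))"
proof -
  obtain m where k: "k = Suc m"
    using assms by (cases k) auto
  \<comment> \<open>The weight reads \<open>xt\<close> and \<open>xt'\<close> only below
    \<open>k\<close>, so their updates at \<open>k\<close> survive only in the last measurement
    factor.\<close>
  have "post_matrix p U f y k $ a $ a' = (\<Sum>x0\<in>UNIV. \<Sum>x\<in>paths k. \<Sum>x'\<in>paths k.
      \<Sum>xt\<in>paths m. \<Sum>xt'\<in>paths m. prefix_weight p U f y k x0 x x' xt xt' * f k (x k) (x' k) a a' (y k))"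
    unfolding post_matrix_def k
    by (simp add: sum_PiE_Suc_fixed del: One_nat_def)
       (intro sum.cong refl arg_cong2[where f = "(*)"] prefix_weight_cong; simp)
  \<comment> \<open>Grouping by \<open>x k\<close> and \<open>x' k\<close> produces the two indices
    of C_k.\<close>
  also have "\<dots> = (\<Sum>x0\<in>UNIV. \<Sum>b\<in>UNIV. \<Sum>b'\<in>UNIV.
      \<Sum>x\<in>{x \<in> paths k. x k = b}. \<Sum>x'\<in>{x' \<in> paths k. x' k = b'}.
      \<Sum>xt\<in>paths m. \<Sum>xt'\<in>paths m. prefix_weight p U f y k x0 x x' xt xt' * f k b b' a a' (y k))"
    by (intro sum.cong refl) (simp only: sum_fibers2 finite_paths)
  also have "\<dots> = (\<Sum>b\<in>UNIV. \<Sum>b'\<in>UNIV. \<Sum>x0\<in>UNIV.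
      \<Sum>x\<in>{x \<in> paths k. x k = b}. \<Sum>x'\<in>{x' \<in> paths k. x' k = b'}.
      \<Sum>xt\<in>paths m. \<Sum>xt'\<in>paths m. prefix_weight p U f y k x0 x x' xt xt' * f k b b' a a' (y k))"
    by (rule sum_pull2[symmetric])
  finally show ?thesis
    unfolding pre_matrix_def k by (simp add: sum_distrib_right)
qed

lemma pre_matrix_Suc:
  assumes "1 \<le> k"
  shows "pre_matrix p U f y (Suc k) = U k ** post_matrix p U f y k ** hermitian_transpose (U k)"
proof -
  let ?W = "\<lambda>x0 x x' xt xt'. prefix_weight p U f y k x0 x x' xt xt' * f k (x k) (x' k) (xt k) (xt' k) (y k)"
  have "pre_matrix p U f y (Suc k) $ a $ a'
    = (U k ** post_matrix p U f y k ** hermitian_transpose (U k)) $ a $ a'" for a a'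
  proof -
    \<comment> \<open>The new values at \<open>Suc k\<close> enter only through \<open>U k\<close>,
      so the remaining weight does not see them.\<close>
    have "prefix_weight p U f y k x0 (x(Suc k := a)) (x'(Suc k := a')) xt xt'
        = prefix_weight p U f y k x0 x x' xt xt'" for x0 x x' xt xt'
      using assms by (intro prefix_weight_cong) auto
    then have "pre_matrix p U f y (Suc k) $ a $ a' = (\<Sum>x0\<in>UNIV. \<Sum>x\<in>paths k. \<Sum>x'\<in>paths k.
        \<Sum>xt\<in>paths k. \<Sum>xt'\<in>paths k. ?W x0 x x' xt xt' * (U k $ a $ xt k * cnj (U k $ a' $ xt' k)))"
      unfolding pre_matrix_def using assms
      by (simp add: sum_PiE_Suc_fixed prefix_weight_Suc del: One_nat_def)
    \<comment> \<open>The values \<open>xt k\<close> and \<open>xt' k\<close> become the indices of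
      D_k, and the entries of \<open>U k\<close> become constants on each fiber.\<close>
    also have "\<dots> = (\<Sum>x0\<in>UNIV. \<Sum>x\<in>paths k. \<Sum>x'\<in>paths k. \<Sum>b\<in>UNIV. \<Sum>b'\<in>UNIV.
        \<Sum>xt\<in>{xt \<in> paths k. xt k = b}. \<Sum>xt'\<in>{xt' \<in> paths k. xt' k = b'}.
        ?W x0 x x' xt xt' * (U k $ a $ b * cnj (U k $ a' $ b')))"
      by (intro sum.cong refl) (simp only: sum_fibers2 finite_paths)
    also have "\<dots> = (\<Sum>b\<in>UNIV. \<Sum>b'\<in>UNIV. \<Sum>x0\<in>UNIV. \<Sum>x\<in>paths k. \<Sum>x'\<in>paths k.
        \<Sum>xt\<in>{xt \<in> paths k. xt k = b}. \<Sum>xt'\<in>{xt' \<in> paths k. xt' k = b'}.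
        ?W x0 x x' xt xt' * (U k $ a $ b * cnj (U k $ a' $ b')))"
      by (rule sum_pull2_nested[symmetric])
    finally show ?thesis
      unfolding conjugation_nth post_matrix_def by (simp add: sum_distrib_right)
  qed
  then show ?thesis
    by (simp add: vec_eq_iff)
qed

text \<open>There are \<open>n\<close> measurement factors but only \<open>n-1\<close> unitaries
  between them. Setting \<open>f n\<close> aside leaves the prefix weight, and the final equality
  constraint selects the diagonal of D_n.\<close>

lemma joint_mass_eq_trace:
  assumes "1 \<le> n"
  shows "joint_mass n p U f y = trace (post_matrix p U f y n)"
proof -
  let ?W = "\<lambda>x0 x x' xt xt'. prefix_weight p U f y n x0 x x' xt xt' * f n (x n) (x' n) (xt n) (xt' n) (y n)"
  have n: "{1..n} = insert n {1..n-1}"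
    using assms by auto
  have "joint_mass n p U f y = (\<Sum>x0\<in>UNIV. \<Sum>x\<in>paths n. \<Sum>x'\<in>paths n. \<Sum>xt\<in>paths n. \<Sum>xt'\<in>paths n.
      ?W x0 x x' xt xt' * equality_constraint (xt n) (xt' n))"
    unfolding joint_mass_def
  proof (intro sum.cong refl)
    fix x0 x x' xt xt'
    have "(\<Prod>j=1..n. f j (x j) (x' j) (xt j) (xt' j) (y j))
       = f n (x n) (x' n) (xt n) (xt' n) (y n) * (\<Prod>j=1..n-1. f j (x j) (x' j) (xt j) (xt' j) (y j))"
      unfolding n using assms by (subst prod.insert) auto
    then show "complex_of_real (pmf p x0) * U 0 $ x 1 $ x0 * cnj (U 0 $ x' 1 $ x0) *
        (\<Prod>j=1..n. f j (x j) (x' j) (xt j) (xt' j) (y j)) *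
        (\<Prod>j=1..n-1. U j $ x (j+1) $ xt j * cnj (U j $ x' (j+1) $ xt' j)) *
        equality_constraint (xt n) (xt' n) = ?W x0 x x' xt xt' * equality_constraint (xt n) (xt' n)"
      by (simp add: prefix_weight_def prod.distrib algebra_simps)
  qed
  also have "\<dots> = (\<Sum>x0\<in>UNIV. \<Sum>x\<in>paths n. \<Sum>x'\<in>paths n. \<Sum>b\<in>UNIV. \<Sum>b'\<in>UNIV.
      \<Sum>xt\<in>{xt \<in> paths n. xt n = b}. \<Sum>xt'\<in>{xt' \<in> paths n. xt' n = b'}.
      ?W x0 x x' xt xt' * equality_constraint b b')"
    by (intro sum.cong refl) (simp only: sum_fibers2 finite_paths)
  also have "\<dots> = (\<Sum>b\<in>UNIV. \<Sum>b'\<in>UNIV. \<Sum>x0\<in>UNIV. \<Sum>x\<in>paths n. \<Sum>x'\<in>paths n.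
      \<Sum>xt\<in>{xt \<in> paths n. xt n = b}. \<Sum>xt'\<in>{xt' \<in> paths n. xt' n = b'}.
      ?W x0 x x' xt xt' * equality_constraint b b')"
    by (rule sum_pull2_nested[symmetric])
  also have "\<dots> = (\<Sum>b\<in>UNIV. \<Sum>b'\<in>UNIV. post_matrix p U f y n $ b $ b' * equality_constraint b b')"
    unfolding post_matrix_def by (simp add: sum_distrib_right)
  also have "\<dots> = trace (post_matrix p U f y n)"
    unfolding trace_def
    by (intro sum.cong refl)
       (simp add: equality_constraint_def if_distrib[where f = "\<lambda>z. _ * z"] cong: if_cong)
  finally show ?thesis .
qed

section \<open>Unnormalized mixed states and the operators accumulated along an outcome
  sequence\<close>

text \<open>The initial density matrix, diagonal with the probabilities \<open>p\<close>, conjugated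
  by the operator \<open>V\<close>.\<close>

definition mixture :: "'m pmf \<Rightarrow> complex^'m^'m \<Rightarrow> complex^'m^'m::finite" where
  "mixture p V = V ** (\<chi> i j. if i = j then complex_of_real (pmf p i) else 0) ** hermitian_transpose V"

lemma mixture_mult: "mixture p (A ** V) = A ** mixture p V ** hermitian_transpose A"
  by (simp add: mixture_def hermitian_transpose_mult matrix_mul_assoc)

lemma mixture_nth:
  "mixture p V $ a $ a' = (\<Sum>x\<in>UNIV. complex_of_real (pmf p x) * V $ a $ x * cnj (V $ a' $ x))"
  unfolding mixture_def conjugation_nth
  by (intro sum.cong refl) (simp add: if_distrib[where f = "\<lambda>z. z * _"] mult.assoc cong: if_cong)

text \<open>The diagonal entries are sums of weighted squared moduli. This is why taking
  \<open>Re\<close> of such a trace loses nothing and gives a nonnegative weight.\<close>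

lemma trace_mixture:
  "trace (mixture p V) = complex_of_real (\<Sum>a\<in>UNIV. \<Sum>x\<in>UNIV. pmf p x * (cmod (V $ a $ x))\<^sup>2)"
  by (simp add: trace_def mixture_nth mult.assoc
      flip: complex_norm_square of_real_power of_real_mult of_real_sum)

lemma trace_mixture_Re: "trace (mixture p V) = complex_of_real (Re (trace (mixture p V)))"
  by (simp add: trace_mixture)

lemma trace_mixture_nonneg: "0 \<le> Re (trace (mixture p V))"
  by (simp add: trace_mixture sum_nonneg)

lemma trace_mixture_unitary:
  assumes "unitary U"
  shows "trace (mixture p (U ** V)) = trace (mixture p V)"
  using assms by (simp add: mixture_mult trace_conjugation unitary_def)

text \<open>The operator K right after measurement \<open>k\<close>. The indices are shifted:
  \<open>U k\<close> acts between measurements \<open>k\<close> and \<open>Suc k\<close>.\<close>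

primrec kraus ::
    "(nat \<Rightarrow> complex^'m^'m) \<Rightarrow> (nat \<Rightarrow> 'o \<Rightarrow> complex^'m^'m) \<Rightarrow> (nat \<Rightarrow> 'o) \<Rightarrow> nat \<Rightarrow> complex^'m^'m" where
  "kraus U A y 0 = mat 1"
| "kraus U A y (Suc k) = A (Suc k) (y (Suc k)) ** (U k ** kraus U A y k)"

lemma kraus_cong:
  assumes "\<And>j. j \<in> {1..k} \<Longrightarrow> y j = w j"
  shows "kraus U A y k = kraus U A w k"
  using assms by (induction k) auto

lemma post_matrix_mixture:
  assumes "1 \<le> k" "pre_matrix p U f y k = mixture p V"
    "\<And>x x' xt xt'. f k x x' xt xt' (y k) = A $ xt $ x * cnj (A $ xt' $ x')"
  shows "post_matrix p U f y k = mixture p (A ** V)"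
  unfolding vec_eq_iff using assms(1)
  by (simp add: post_matrix_nth mixture_mult conjugation_nth assms(2,3))

lemma pre_matrix_kraus:
  assumes "\<And>j x x' xt xt'. j \<in> {1..k} \<Longrightarrow>
    f j x x' xt xt' (y j) = A j (y j) $ xt $ x * cnj (A j (y j) $ xt' $ x')"
  shows "pre_matrix p U f y (Suc k) = mixture p (U k ** kraus U A y k)"
  using assms
proof (induction k)
  case 0
  then show ?case
    by (simp add: vec_eq_iff pre_matrix_1 mixture_nth)
next
  case (Suc k)
  then have "post_matrix p U f y (Suc k) = mixture p (kraus U A y (Suc k))"
    by (simp add: post_matrix_mixture)
  then show ?case
    by (simp add: pre_matrix_Suc mixture_mult)
qed

section \<open>Probabilities of outcome prefixes as traces\<close>

text \<open>Marginalization one coordinate at a time, from \<open>n\<close> down to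
  \<open>m\<close>. By \<open>t_cong\<close> the weight \<open>t m\<close> depends only on the first
  \<open>m\<close> coordinates.\<close>

lemma sum_PiE_prefix:
  fixes t :: "nat \<Rightarrow> (nat \<Rightarrow> 'o) \<Rightarrow> real"
  assumes marginal: "\<And>m y. m < n \<Longrightarrow> (\<And>j. j \<in> {1..m} \<Longrightarrow> y j \<in> Y j) \<Longrightarrow>
      (\<Sum>a\<in>Y (Suc m). t (Suc m) (y(Suc m := a))) = t m y"
    and t_cong: "\<And>y w. (\<And>j. j \<in> {1..m} \<Longrightarrow> y j = w j) \<Longrightarrow> t m y = t m w"
    and "m \<le> n" "\<And>j. j \<in> {1..m} \<Longrightarrow> y j \<in> Y j"
  shows "(\<Sum>\<omega>\<in>{\<omega> \<in> PiE {1..n} Y. \<forall>j\<in>{1..m}. \<omega> j = y j}. t n \<omega>) = t m y"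
  \<comment> \<open>The hypothesis \<open>marginal\<close> mentions \<open>n\<close>, so it has to
    take part in the induction.\<close>
  using \<open>m \<le> n\<close> marginal
proof (induction n rule: dec_induct)
  case base
  have "{\<omega> \<in> PiE {1..m} Y. \<forall>j\<in>{1..m}. \<omega> j = y j} = {restrict y {1..m}}"
    using assms(4) by (auto simp: PiE_iff extensional_def fun_eq_iff)
  then show ?case
    by (auto intro: t_cong)
next
  case (step n)
  let ?E = "\<lambda>n. {\<omega> \<in> PiE {1..n} Y. \<forall>j\<in>{1..m}. \<omega> j = y j}"
  \<comment> \<open>A sequence of length \<open>Suc n\<close> is a pair of its prefix and its last
    value; since \<open>m\<close> is at most \<open>n\<close>, the condition concerns the prefix
    alone.\<close>
  have "(\<Sum>x\<in>?E (Suc n). t (Suc n) x)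
      = (\<Sum>x\<in>?E n. \<Sum>a\<in>Y (Suc n). t (Suc n) (x(Suc n := a)))"
    unfolding sum.cartesian_product
  proof (rule sum.reindex_bij_witness[where i = "\<lambda>(x, a). x(Suc n := a)"
        and j = "\<lambda>x. (restrict x {1..n}, x (Suc n))"])
    fix x assume "x \<in> ?E (Suc n)"
    then have x: "x \<in> PiE {1..Suc n} Y" and pre: "\<forall>j\<in>{1..m}. x j = y j"
      by auto
    show "(case (restrict x {1..n}, x (Suc n)) of (x, a) \<Rightarrow> x(Suc n := a)) = x"
      "(case (restrict x {1..n}, x (Suc n)) of (x, a) \<Rightarrow> t (Suc n) (x(Suc n := a))) = t (Suc n) x"
      using PiE_restrict_Suc[OF x] by simp_all
    have "x (Suc n) \<in> Y (Suc n)"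
      using x by (rule PiE_mem) simp
    then show "(restrict x {1..n}, x (Suc n)) \<in> ?E n \<times> Y (Suc n)"
      using PiE_restrict_Suc[OF x] pre step.hyps by simp
  next
    fix z assume "z \<in> ?E n \<times> Y (Suc n)"
    then obtain x a where z: "z = (x, a)" and x: "x \<in> PiE {1..n} Y" "\<forall>j\<in>{1..m}. x j = y j"
      and a: "a \<in> Y (Suc n)"
      by auto
    show "(restrict (case z of (x, a) \<Rightarrow> x(Suc n := a)) {1..n}, (case z of (x, a) \<Rightarrow> x(Suc n := a)) (Suc n)) = z"
      using restrict_fun_upd_Suc[OF x(1)] by (simp add: z)
    show "(case z of (x, a) \<Rightarrow> x(Suc n := a)) \<in> ?E (Suc n)"
      using PiE_fun_upd_Suc[where S = Y, OF x(1) a] x(2) step.hyps by (simp add: z)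
  qed
  also have "\<dots> = (\<Sum>x\<in>?E n. t n x)"
    by (intro sum.cong refl step.prems) auto
  also have "\<dots> = t m y"
    by (intro step.IH step.prems) auto
  finally show ?case .
qed

lemma measure_outcome_measure:
  assumes "finite (PiE {1..n} Y)" "\<And>y. y \<in> PiE {1..n} Y \<Longrightarrow> 0 \<le> Re (joint_mass n p U f y)"
  shows "\<P>(\<omega> in outcome_measure n p U Y f. Q \<omega>)
    = (\<Sum>\<omega>\<in>{\<omega> \<in> PiE {1..n} Y. Q \<omega>}. Re (joint_mass n p U f \<omega>))"
  unfolding outcome_measure_def space_point_measure
  using assms by (subst measure_point_measure_finite_if) auto

text \<open>Both equations come from one function \<open>t\<close>, the trace of the accumulated
  state. D_{k+1} has this state after \<open>k+1\<close> outcomes, and C_{k+1} is a unitary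
  conjugate of the one after \<open>k\<close> outcomes.\<close>

lemma
  assumes U: "\<forall>j<n. unitary (U j)" and meas: "\<forall>j\<in>{1..n}. measurement_factor (Y j) (f j)"
    and "k < n" and ys: "\<forall>j\<in>{1..k}. ys j \<in> Y j"
  shows prob_prefix_pre_matrix:
      "complex_of_real (\<P>(\<omega> in outcome_measure n p U Y f. \<forall>j\<in>{1..k}. \<omega> j = ys j))
        = trace (pre_matrix p U f ys (Suc k))"
    and prob_prefix_post_matrix:
      "ys (Suc k) \<in> Y (Suc k) \<Longrightarrow>
       complex_of_real (\<P>(\<omega> in outcome_measure n p U Y f. \<forall>j\<in>{1..Suc k}. \<omega> j = ys j))
        = trace (post_matrix p U f ys (Suc k))"
proof -
  have "\<forall>j\<in>{1..n}. general_measurement (Y j) (f j)"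
    using meas by (auto simp: measurement_factor_def dest: basic_projection_general)
  then have fin: "\<forall>j\<in>{1..n}. finite (Y j)"
    and "\<forall>j\<in>{1..n}. \<exists>A. (\<Sum>y\<in>Y j. hermitian_transpose (A y) ** A y) = mat 1 \<and>
        (\<forall>x x' xt xt'. \<forall>y\<in>Y j. f j x x' xt xt' y = A y $ xt $ x * cnj (A y $ xt' $ x'))"
    by (auto simp: general_measurement_def)
  \<comment> \<open>One choice of operators for all measurements, so that the products
    \<open>kraus U A\<close> make sense.\<close>
  then obtain A where "\<forall>j\<in>{1..n}. (\<Sum>y\<in>Y j. hermitian_transpose (A j y) ** A j y) = mat 1 \<and>
        (\<forall>x x' xt xt'. \<forall>y\<in>Y j. f j x x' xt xt' y = A j y $ xt $ x * cnj (A j y $ xt' $ x'))"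
    by (metis (no_types) bchoice)
  then have A: "\<And>j. j \<in> {1..n} \<Longrightarrow> (\<Sum>y\<in>Y j. hermitian_transpose (A j y) ** A j y) = mat 1"
    and f: "\<And>j x x' xt xt' y. j \<in> {1..n} \<Longrightarrow> y \<in> Y j \<Longrightarrow>
        f j x x' xt xt' y = A j y $ xt $ x * cnj (A j y $ xt' $ x')"
    by auto
  define t where "t m y = Re (trace (mixture p (kraus U A y m)))" for m y
  have of_real_t: "complex_of_real (t m y) = trace (mixture p (kraus U A y m))" for m y
    unfolding t_def by (rule trace_mixture_Re[symmetric])
  have pre: "pre_matrix p U f y (Suc m) = mixture p (U m ** kraus U A y m)"
    if "m < n" "\<And>j. j \<in> {1..m} \<Longrightarrow> y j \<in> Y j" for m y
    using that by (intro pre_matrix_kraus f) auto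
  have post: "post_matrix p U f y (Suc m) = mixture p (kraus U A y (Suc m))"
    if "m < n" "\<And>j. j \<in> {1..Suc m} \<Longrightarrow> y j \<in> Y j" for m y
    unfolding kraus.simps using that by (intro post_matrix_mixture pre f) auto
  have mass: "Re (joint_mass n p U f y) = t n y" if "y \<in> PiE {1..n} Y" for y
  proof -
    obtain m where n: "n = Suc m"
      using \<open>k < n\<close> by (cases n) auto
    show ?thesis
      using that post[of m y] by (auto simp: n joint_mass_eq_trace t_def PiE_iff simp del: kraus.simps)
  qed
  \<comment> \<open>The operator accumulated up to \<open>m\<close> ignores the outcome at
    \<open>Suc m\<close>. Completeness then removes measurement \<open>Suc m\<close>, and unitarity
    removes \<open>U m\<close>.\<close>
  have marginal: "(\<Sum>a\<in>Y (Suc m). t (Suc m) (y(Suc m := a))) = t m y" if "m < n" for m y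
  proof -
    have "kraus U A (y(Suc m := a)) m = kraus U A y m" for a
      by (rule kraus_cong) auto
    then have "complex_of_real (\<Sum>a\<in>Y (Suc m). t (Suc m) (y(Suc m := a)))
        = (\<Sum>a\<in>Y (Suc m). trace (A (Suc m) a ** mixture p (U m ** kraus U A y m)
            ** hermitian_transpose (A (Suc m) a)))"
      by (simp add: of_real_t mixture_mult)
    also have "\<dots> = trace (mixture p (U m ** kraus U A y m))"
      using that by (intro sum_trace_conjugation A) auto
    also have "\<dots> = complex_of_real (t m y)"
      using U that by (simp add: trace_mixture_unitary of_real_t)
    finally show ?thesis
      by (simp only: of_real_eq_iff)
  qed
  have prob: "\<P>(\<omega> in outcome_measure n p U Y f. \<forall>j\<in>{1..m}. \<omega> j = ys j) = t m ys"
    if "m \<le> n" "\<And>j. j \<in> {1..m} \<Longrightarrow> ys j \<in> Y j" for m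
  proof -
    have "\<P>(\<omega> in outcome_measure n p U Y f. \<forall>j\<in>{1..m}. \<omega> j = ys j)
      = (\<Sum>\<omega>\<in>{\<omega> \<in> PiE {1..n} Y. \<forall>j\<in>{1..m}. \<omega> j = ys j}. t n \<omega>)"
    proof (subst measure_outcome_measure)
      show "finite (PiE {1..n} Y)"
        using fin by (intro finite_PiE) auto
      show "0 \<le> Re (joint_mass n p U f y)" if "y \<in> PiE {1..n} Y" for y
        by (simp add: mass[OF that] t_def trace_mixture_nonneg)
      show "(\<Sum>\<omega>\<in>{\<omega> \<in> PiE {1..n} Y. \<forall>j\<in>{1..m}. \<omega> j = ys j}. Re (joint_mass n p U f \<omega>))
        = (\<Sum>\<omega>\<in>{\<omega> \<in> PiE {1..n} Y. \<forall>j\<in>{1..m}. \<omega> j = ys j}. t n \<omega>)"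
        by (intro sum.cong refl mass) simp
    qed
    also have "\<dots> = t m ys"
    proof (rule sum_PiE_prefix)
      show "t m y = t m w" if "\<And>j. j \<in> {1..m} \<Longrightarrow> y j = w j" for y w
      proof -
        have "kraus U A y m = kraus U A w m"
          using that by (intro kraus_cong)
        then show ?thesis
          by (simp add: t_def)
      qed
    qed (rule marginal, assumption, rule \<open>m \<le> n\<close>, rule that(2))
    finally show ?thesis .
  qed
  show "complex_of_real (\<P>(\<omega> in outcome_measure n p U Y f. \<forall>j\<in>{1..k}. \<omega> j = ys j))
        = trace (pre_matrix p U f ys (Suc k))"
    using U ys \<open>k < n\<close> prob[of k] pre[of k ys] by (simp add: of_real_t trace_mixture_unitary)
  show "complex_of_real (\<P>(\<omega> in outcome_measure n p U Y f. \<forall>j\<in>{1..Suc k}. \<omega> j = ys j))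
        = trace (post_matrix p U f ys (Suc k))" if "ys (Suc k) \<in> Y (Suc k)"
  proof -
    have *: "ys j \<in> Y j" if "j \<in> {1..Suc k}" for j
      using ys \<open>ys (Suc k) \<in> Y (Suc k)\<close> that by (cases "j = Suc k") auto
    show ?thesis
      using prob[OF _ *] post[OF _ *] \<open>k < n\<close> by (simp add: of_real_t del: kraus.simps)
  qed
qed

section \<open>Conditional probability and state update for a basic projection\<close>

theorem proposition4:
  fixes n k :: nat
    and p :: "'m::finite pmf"
    and U :: "nat \<Rightarrow> complex^'m^'m"
    and Y :: "nat \<Rightarrow> ('m + 'y) set"
    and f :: "nat \<Rightarrow> ('m, 'y) factor"
    and B :: "complex^'m^'m"
    and ys :: "nat \<Rightarrow> 'm + 'y"
  defines "Pr \<equiv> outcome_measure n p U Y f"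
  assumes "n \<ge> 1"
    and "\<forall>j<n. unitary (U j)"
    and "\<forall>j\<in>{1..n}. measurement_factor (Y j) (f j)"
    and "1 \<le> k" and "k \<le> n"
    and "basic_projection B (Y k) (f k)"
    and "\<forall>j\<in>{1..<k}. ys j \<in> Y j"
    and "\<P>(\<omega> in Pr. \<forall>j\<in>{1..<k}. \<omega> j = ys j) > 0"
  shows "\<forall>y::'m.
      complex_of_real (\<P>(\<omega> in Pr. \<omega> k = Inl y \<bar> \<forall>j\<in>{1..<k}. \<omega> j = ys j))
        = (hermitian_transpose (col B y) ** pre_density p U f ys k ** col B y) $ 1 $ 1
    \<and> (hermitian_transpose (col B y) ** pre_density p U f ys k ** col B y) $ 1 $ 1
        = trace (col B y ** hermitian_transpose (col B y) ** pre_density p U f ys k)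
    \<and> (\<P>(\<omega> in Pr. \<omega> k = Inl y \<bar> \<forall>j\<in>{1..<k}. \<omega> j = ys j) > 0
        \<longrightarrow> post_density p U f (ys(k := Inl y)) k
              = col B y ** hermitian_transpose (col B y))"
proof
  fix y :: 'm
  obtain m where k: "k = Suc m"
    using \<open>1 \<le> k\<close> by (cases k) auto
  have range: "{1..<Suc m} = {1..m}"
    by auto
  let ?zs = "ys(k := Inl y)"
  let ?C = "pre_matrix p U f ys k"
  let ?D = "post_matrix p U f ?zs k"
  let ?P0 = "\<P>(\<omega> in Pr. \<forall>j\<in>{1..<k}. \<omega> j = ys j)"
  let ?P1 = "\<P>(\<omega> in Pr. \<omega> k = Inl y \<and> (\<forall>j\<in>{1..<k}. \<omega> j = ys j))"
  \<comment> \<open>The quadratic form of the unnormalized C_k at column \<open>y\<close> of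
    \<open>B\<close>.\<close>
  define q where "q = (\<Sum>b\<in>UNIV. \<Sum>b'\<in>UNIV. ?C $ b $ b' * (cnj (B $ b $ y) * B $ b' $ y))"
  have Yk: "Y k = range Inl" and B: "unitary B"
    and fk: "\<And>x x' xt xt' y. f k x x' xt xt' (Inl y) =
        B $ xt $ y * cnj (B $ x $ y) * (B $ x' $ y * cnj (B $ xt' $ y))"
    using assms(7) by (auto simp: basic_projection_def)
  have norm1: "(\<Sum>a\<in>UNIV. B $ a $ y * cnj (B $ a $ y)) = 1"
    using B by (auto simp: unitary_def vec_eq_iff matrix_matrix_mult_def hermitian_transpose_def
        map_matrix_def transpose_def mat_def mult.commute)
  have P0: "complex_of_real ?P0 = trace ?C"
    using assms(3,4,6,8) k unfolding Pr_def range k by (intro prob_prefix_pre_matrix) auto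
  \<comment> \<open>The joint event of the conditional probability is itself a prefix event, of
    length \<open>k\<close>, for the updated outcomes.\<close>
  have "\<omega> k = Inl y \<and> (\<forall>j\<in>{1..<k}. \<omega> j = ys j) \<longleftrightarrow> (\<forall>j\<in>{1..k}. \<omega> j = ?zs j)" for \<omega>
    unfolding k range by (auto simp: atLeastAtMostSuc_conv)
  then have "?P1 = \<P>(\<omega> in Pr. \<forall>j\<in>{1..k}. \<omega> j = ?zs j)"
    by simp
  also have "complex_of_real \<dots> = trace ?D"
    using assms(3,4,6,8) k Yk unfolding Pr_def range k by (intro prob_prefix_post_matrix) auto
  finally have P1: "complex_of_real ?P1 = trace ?D" .
  \<comment> \<open>C_k reads outcomes only below \<open>k\<close>, so recording
    \<open>Inl y\<close> at \<open>k\<close> leaves it unchanged.\<close>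
  have "pre_matrix p U f ?zs k = ?C"
    using \<open>1 \<le> k\<close> by (intro pre_matrix_cong) auto
  \<comment> \<open>The measurement factor separates into a part in the old indices, which sums to
    \<open>q\<close>, and the entry of the projection at the new ones.\<close>
  then have D: "?D $ a $ a' = q * (B $ a $ y * cnj (B $ a' $ y))" for a a'
    using \<open>1 \<le> k\<close> by (simp add: post_matrix_nth fk q_def sum_distrib_left sum_distrib_right mult_ac)
  have trD: "trace ?D = q"
    by (simp add: trace_def D norm1 flip: sum_distrib_left)
  have quad: "(hermitian_transpose (col B y) ** pre_density p U f ys k ** col B y) $ 1 $ 1 = q / trace ?C"
    unfolding q_def sum_divide_distrib
    by (simp add: matrix_matrix_mult_def hermitian_transpose_def map_matrix_def transpose_def col_def
        columnvector_def column_def pre_density_def trace_normalize_def sum_distrib_right)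
       (subst sum.swap, simp add: algebra_simps)
  have "trace (col B y ** hermitian_transpose (col B y) ** pre_density p U f ys k)
      = trace (hermitian_transpose (col B y) ** pre_density p U f ys k ** col B y)"
    by (metis trace_mul_sym matrix_mul_assoc)
  \<comment> \<open>The trace of a matrix of size 1 is its only entry.\<close>
  then have tr: "(hermitian_transpose (col B y) ** pre_density p U f ys k ** col B y) $ 1 $ 1
        = trace (col B y ** hermitian_transpose (col B y) ** pre_density p U f ys k)"
    by (simp add: trace_def)
  \<comment> \<open>The conditional probability is a quotient of prefix probabilities, hence of the
    traces of D_k and C_k.\<close>
  have cond: "complex_of_real (\<P>(\<omega> in Pr. \<omega> k = Inl y \<bar> \<forall>j\<in>{1..<k}. \<omega> j = ys j)) = q / trace ?C"
    by (simp add: cond_prob_def P0 P1 trD del: One_nat_def)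
  have "post_density p U f ?zs k = col B y ** hermitian_transpose (col B y)"
    if "\<P>(\<omega> in Pr. \<omega> k = Inl y \<bar> \<forall>j\<in>{1..<k}. \<omega> j = ys j) > 0"
  proof -
    \<comment> \<open>If \<open>q\<close> were 0, the conditional probability would vanish. Now
      \<open>q\<close> cancels when D_k is divided by its trace.\<close>
    have "q \<noteq> 0"
      using that cond by auto
    then show ?thesis
      by (simp add: vec_eq_iff post_density_def trace_normalize_def map_matrix_def trD D
          matrix_matrix_mult_def hermitian_transpose_def transpose_def col_def columnvector_def column_def)
  qed
  with cond quad tr show "complex_of_real (\<P>(\<omega> in Pr. \<omega> k = Inl y \<bar> \<forall>j\<in>{1..<k}. \<omega> j = ys j))
        = (hermitian_transpose (col B y) ** pre_density p U f ys k ** col B y) $ 1 $ 1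
    \<and> (hermitian_transpose (col B y) ** pre_density p U f ys k ** col B y) $ 1 $ 1
        = trace (col B y ** hermitian_transpose (col B y) ** pre_density p U f ys k)
    \<and> (\<P>(\<omega> in Pr. \<omega> k = Inl y \<bar> \<forall>j\<in>{1..<k}. \<omega> j = ys j) > 0
        \<longrightarrow> post_density p U f (ys(k := Inl y)) k
              = col B y ** hermitian_transpose (col B y))"
    by simp
qed

end
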